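(* Let $G=(V,E)$ be a graph on $n$ vertices. For every integer $k$ with $1\le k\le n$, $$\alpha_k(G)\leq\varphi_k(G)\leq\vartheta_k(G).$$ The second inequality, $\varphi_k(G)\leq\vartheta_k(G)$, also holds for every real $k$ with $0\le k\le n$.
   Context: Graphs are finite and simple with nonempty vertex set $V$; $A_G$ is the adjacency matrix. $\mathbb{S}^V$ is the set of real symmetric $V\times V$ matrices and $\mathbb{S}^V_+$ the subset of positive semidefinite ones; $A\preceq B$ means $B-A\in\mathbb{S}^V_+$. $I$ is the identity matrix, $J$ the all-ones matrix, $\mathbf{1}$ the all-ones vector, $\circ$ the entrywise (Schur) product, $\langle A,B\rangle=\operatorname{trace}(AB)$, and $\operatorname{diag}(Y)\in\mathbb{R}^V$ is the vector of diagonal entries of $Y$. $\alpha_k(G)$ is the largest number of vertices of an induced subgraph of $G$ that is $k$-colorable. For real $k\in[0,n]$, $$\vartheta_k(G)=\max\{\langle J,X\rangle : X\in\mathbb{S}^V,\ \langle I,X\rangle=k,\ A_G\circ X=0,\ 0\preceq X\preceq I\},$$ $$\varphi_k(G)=\max\{\langle M,Y\rangle : M,Y\in\mathbb{S}^V_+,\ \operatorname{diag}(Y)=\mathbf{1},\ A_G\circ Y=0,\ \langle I,M\rangle=k,\ M\preceq I\}.$$ For a positive integer $k\le n$, $\varphi_k(G)$ equals the maximum of $\sum_{i=1}^k\lambda_i(Y)$ (sum of the $k$ largest eigenvalues) over $Y\in\mathbb{S}^V_+$ with $\operatorname{diag}(Y)=\mathbf{1}$ and $A_G\circ Y=0$.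 *)

theory Defs
  imports "HOL-Analysis.Analysis"
begin

text \<open>
  A finite simple graph with nonempty vertex set is a symmetric irreflexive relation on a finite
  type \<open>'v\<close>; the number of vertices is \<open>CARD('v)\<close>, and matrices indexed by the vertices have type
  \<open>real ^ 'v ^ 'v\<close>.
\<close>

definition simple_graph :: "('v \<Rightarrow> 'v \<Rightarrow> bool) \<Rightarrow> bool" where
  "simple_graph E \<longleftrightarrow> symp E \<and> irreflp E"

definition adj_matrix :: "('v::finite \<Rightarrow> 'v \<Rightarrow> bool) \<Rightarrow> real ^ 'v ^ 'v" where
  "adj_matrix E = (\<chi> u v. if E u v then 1 else 0)"

definition induced_colorable :: "nat \<Rightarrow> ('v \<Rightarrow> 'v \<Rightarrow> bool) \<Rightarrow> 'v set \<Rightarrow> bool" where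
  "induced_colorable k E S \<longleftrightarrow>
     (\<exists>c :: 'v \<Rightarrow> nat. (\<forall>u\<in>S. c u < k) \<and> (\<forall>u\<in>S. \<forall>v\<in>S. E u v \<longrightarrow> c u \<noteq> c v))"

definition alpha :: "nat \<Rightarrow> ('v::finite \<Rightarrow> 'v \<Rightarrow> bool) \<Rightarrow> nat" where
  "alpha k E = Max {card S | S. induced_colorable k E S}"

definition sym_mat :: "real ^ 'v ^ 'v \<Rightarrow> bool" where
  "sym_mat A \<longleftrightarrow> transpose A = A"

definition psd :: "real ^ 'v ^ 'v::finite \<Rightarrow> bool" where
  "psd A \<longleftrightarrow> sym_mat A \<and> (\<forall>x. 0 \<le> x \<bullet> (A *v x))"

definition loewner_le :: "real ^ 'v ^ 'v::finite \<Rightarrow> real ^ 'v ^ 'v \<Rightarrow> bool"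
    (infix \<open>\<preceq>\<close> 50) where
  "A \<preceq> B \<longleftrightarrow> psd (B - A)"

definition all_ones :: "real ^ 'v ^ 'v" where
  "all_ones = (\<chi> u v. 1)"

definition schur :: "real ^ 'v ^ 'v \<Rightarrow> real ^ 'v ^ 'v \<Rightarrow> real ^ 'v ^ 'v" where
  "schur A B = (\<chi> u v. A $ u $ v * B $ u $ v)"

definition mat_inner :: "real ^ 'v ^ 'v::finite \<Rightarrow> real ^ 'v ^ 'v \<Rightarrow> real" where
  "mat_inner A B = trace (A ** B)"

definition diag_vec :: "real ^ 'v ^ 'v \<Rightarrow> real ^ 'v" where
  "diag_vec A = (\<chi> u. A $ u $ u)"

definition theta_feasible :: "real \<Rightarrow> ('v::finite \<Rightarrow> 'v \<Rightarrow> bool) \<Rightarrow> (real ^ 'v ^ 'v) set" where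
  "theta_feasible k E =
     {X. sym_mat X \<and> mat_inner (mat 1) X = k \<and> schur (adj_matrix E) X = 0 \<and> 0 \<preceq> X \<and> X \<preceq> mat 1}"

definition phi_feasible ::
    "real \<Rightarrow> ('v::finite \<Rightarrow> 'v \<Rightarrow> bool) \<Rightarrow> ((real ^ 'v ^ 'v) \<times> (real ^ 'v ^ 'v)) set" where
  "phi_feasible k E =
     {(M, Y). psd M \<and> psd Y \<and> diag_vec Y = (\<chi> u. 1) \<and> schur (adj_matrix E) Y = 0 \<and>
        mat_inner (mat 1) M = k \<and> M \<preceq> mat 1}"

text \<open>
  \<open>GREATEST\<close> denotes an attained maximum, so it is unspecified when none exists. The lemmas
  \<open>theta_attained\<close> and \<open>phi_attained\<close> below show that for \<open>0 \<le> k \<le> CARD('v)\<close> both maxima do exist.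
\<close>

definition theta :: "real \<Rightarrow> ('v::finite \<Rightarrow> 'v \<Rightarrow> bool) \<Rightarrow> real" where
  "theta k E = (GREATEST r. \<exists>X \<in> theta_feasible k E. r = mat_inner all_ones X)"

definition phi :: "real \<Rightarrow> ('v::finite \<Rightarrow> 'v \<Rightarrow> bool) \<Rightarrow> real" where
  "phi k E = (GREATEST r. \<exists>(M, Y) \<in> phi_feasible k E. r = mat_inner M Y)"

lemma Greatest_attained:
  fixes f :: "'a::topological_space \<Rightarrow> real"
  assumes "compact S" "S \<noteq> {}" "continuous_on S f"
  shows "\<exists>x\<in>S. (GREATEST r. \<exists>x\<in>S. r = f x) = f x \<and> (\<forall>y\<in>S. f y \<le> f x)"
proof -
  obtain x where x: "x \<in> S" "\<forall>y\<in>S. f y \<le> f x"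
    using continuous_attains_sup[OF assms] by blast
  have "(GREATEST r. \<exists>x\<in>S. r = f x) = f x"
    by (rule Greatest_equality) (use x in auto)
  with x show ?thesis by blast
qed

lemma continuous_mat_inner [continuous_intros]:
  fixes f g :: "'a::topological_space \<Rightarrow> real ^ 'v ^ 'v::finite"
  assumes "continuous_on S f" "continuous_on S g"
  shows "continuous_on S (\<lambda>x. mat_inner (f x) (g x))"
  unfolding mat_inner_def trace_def matrix_matrix_mult_def
  by (simp, intro continuous_intros assms)

lemma closed_psd: "closed {A :: real ^ 'v ^ 'v::finite. psd A}"
proof -
  have eq: "{A :: real ^ 'v ^ 'v. psd A} =
      (\<Inter>u. \<Inter>v. {A. A $ u $ v = A $ v $ u}) \<inter>
      (\<Inter>x. {A. 0 \<le> (\<Sum>u\<in>UNIV. x $ u * (\<Sum>v\<in>UNIV. A $ u $ v * x $ v))})"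
    by (auto simp: psd_def sym_mat_def transpose_def vec_eq_iff inner_vec_def
        matrix_vector_mult_def)
  show ?thesis
    unfolding eq by (intro closed_Int closed_INT ballI closed_Collect_eq closed_Collect_le
        continuous_intros)
qed

lemma psd_diag_nonneg:
  assumes "psd A" shows "0 \<le> A $ u $ u"
proof -
  have "0 \<le> axis u 1 \<bullet> (A *v axis u 1)"
    using assms unfolding psd_def by blast
  then show ?thesis
    by (simp add: inner_axis' matrix_vector_mult_basis column_def)
qed

lemma psd_entry_bound:
  assumes "psd A" shows "\<bar>A $ u $ v\<bar> \<le> (A $ u $ u + A $ v $ v) / 2"
proof -
  have sym: "A $ v $ u = A $ u $ v"
    using assms unfolding psd_def sym_mat_def by (metis transpose_def vec_lambda_beta)
  have *: "0 \<le> A $ u $ u + s * (2 * A $ u $ v) + s * s * A $ v $ v" for s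
  proof -
    let ?x = "axis u 1 + s *\<^sub>R axis v 1"
    have "0 \<le> ?x \<bullet> (A *v ?x)"
      using assms unfolding psd_def by blast
    then show ?thesis
      by (simp add: inner_axis' matrix_vector_mult_basis column_def matrix_vector_right_distrib
          inner_add_left matrix_vector_mult_scaleR sym algebra_simps)
  qed
  show ?thesis using *[of 1] *[of "-1"] by simp
qed

lemma norm_mat_le:
  fixes A :: "real ^ 'v ^ 'v::finite"
  assumes "\<And>u v. \<bar>A $ u $ v\<bar> \<le> 1"
  shows "norm A \<le> real CARD('v) * real CARD('v)"
proof -
  have "norm (A $ u) \<le> real CARD('v)" for u
    using norm_le_l1_cart[of "A $ u"] sum_bounded_above[of UNIV "\<lambda>v. \<bar>A $ u $ v\<bar>" 1] assms
    by (simp add: order_trans)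
  then have "(\<Sum>u\<in>UNIV. norm (A $ u)) \<le> real CARD('v) * real CARD('v)"
    using sum_bounded_above[of UNIV "\<lambda>u. norm (A $ u)" "real CARD('v)"] by simp
  moreover have "norm A \<le> (\<Sum>u\<in>UNIV. norm (A $ u))"
    unfolding norm_vec_def by (rule L2_set_le_sum) simp
  ultimately show ?thesis by linarith
qed

lemma psd_norm_bound:
  fixes A :: "real ^ 'v ^ 'v::finite"
  assumes "psd A" "\<And>u. A $ u $ u \<le> 1"
  shows "norm A \<le> real CARD('v) * real CARD('v)"
proof (rule norm_mat_le)
  fix u v :: 'v
  have "(A $ u $ u + A $ v $ v) / 2 \<le> 1"
    using assms(2)[of u] assms(2)[of v] by simp
  with psd_entry_bound[OF assms(1), of u v] show "\<bar>A $ u $ v\<bar> \<le> 1"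
    by (rule order_trans)
qed

lemma loewner_le_mat_1_diag:
  assumes "A \<preceq> mat 1" shows "A $ u $ u \<le> 1"
  using psd_diag_nonneg[of "mat 1 - A" u] assms by (simp add: loewner_le_def mat_def)

lemma closed_schur_zero: "closed {X :: real ^ 'v ^ 'v::finite. schur A X = 0}"
proof -
  have eq: "{X. schur A X = 0} = (\<Inter>u. \<Inter>v. {X. A $ u $ v * X $ u $ v = 0})"
    by (auto simp: schur_def vec_eq_iff)
  show ?thesis
    unfolding eq by (intro closed_INT ballI closed_Collect_eq continuous_intros)
qed

lemma closed_diag_one: "closed {X :: real ^ 'v ^ 'v::finite. diag_vec X = (\<chi> u. 1)}"
proof -
  have eq: "{X. diag_vec X = (\<chi> u. 1)} = (\<Inter>u. {X :: real ^ 'v ^ 'v. X $ u $ u = 1})"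
    by (auto simp: diag_vec_def vec_eq_iff)
  show ?thesis
    unfolding eq by (intro closed_INT ballI closed_Collect_eq continuous_intros)
qed

lemma closed_le_mat_1: "closed {X :: real ^ 'v ^ 'v::finite. X \<preceq> mat 1}"
proof -
  have eq: "{X :: real ^ 'v ^ 'v. X \<preceq> mat 1} = (\<lambda>X. mat 1 - X) -` {A. psd A}"
    by (auto simp: loewner_le_def)
  show ?thesis
    unfolding eq by (intro closed_vimage closed_psd continuous_intros)
qed

lemma closed_trace_eq: "closed {X :: real ^ 'v ^ 'v::finite. mat_inner (mat 1) X = k}"
  by (intro closed_Collect_eq continuous_intros)

lemma compact_theta_feasible: "compact (theta_feasible k E)"
proof -
  have eq: "theta_feasible k E = {X. mat_inner (mat 1) X = k} \<inter>
      {X. schur (adj_matrix E) X = 0} \<inter> {X. psd X} \<inter> {X. X \<preceq> mat 1}"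
    by (auto simp: theta_feasible_def loewner_le_def psd_def)
  have "closed (theta_feasible k E)"
    unfolding eq by (intro closed_Int closed_trace_eq closed_schur_zero closed_psd closed_le_mat_1)
  moreover have "bounded (theta_feasible k E)"
    unfolding bounded_iff eq using psd_norm_bound loewner_le_mat_1_diag by blast
  ultimately show ?thesis by (simp add: compact_eq_bounded_closed)
qed

lemma compact_phi_feasible: "compact (phi_feasible k E)"
proof -
  let ?M = "{M :: real ^ 'a ^ 'a. psd M} \<inter> {M. mat_inner (mat 1) M = k} \<inter> {M. M \<preceq> mat 1}"
  let ?Y = "{Y :: real ^ 'a ^ 'a. psd Y} \<inter> {Y. diag_vec Y = (\<chi> u. 1)} \<inter>
    {Y. schur (adj_matrix E) Y = 0}"
  have eq: "phi_feasible k E = ?M \<times> ?Y"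
    by (auto simp: phi_feasible_def)
  have "closed ?M"
    by (intro closed_Int closed_trace_eq closed_psd closed_le_mat_1)
  moreover have "bounded ?M"
    unfolding bounded_iff using psd_norm_bound loewner_le_mat_1_diag by blast
  moreover have "closed ?Y"
    by (intro closed_Int closed_diag_one closed_psd closed_schur_zero)
  moreover have "\<forall>Y\<in>?Y. norm Y \<le> real CARD('a) * real CARD('a)"
    by (auto simp: diag_vec_def vec_eq_iff intro!: psd_norm_bound)
  then have "bounded ?Y"
    unfolding bounded_iff by blast
  ultimately show ?thesis
    unfolding eq by (intro compact_Times) (auto simp: compact_eq_bounded_closed)
qed

lemma psd_scaled_mat_1:
  assumes "0 \<le> c" shows "psd (c *\<^sub>R mat 1 :: real ^ 'v ^ 'v::finite)"
proof -
  have "transpose (c *\<^sub>R mat 1 :: real ^ 'v ^ 'v) = c *\<^sub>R mat 1"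
    by (simp add: transpose_def mat_def vec_eq_iff)
  moreover have "0 \<le> x \<bullet> ((c *\<^sub>R mat 1 :: real ^ 'v ^ 'v) *v x)" for x
    using assms by (simp add: scaleR_matrix_vector_assoc[symmetric])
  ultimately show ?thesis by (simp add: psd_def sym_mat_def)
qed

lemma scaled_mat_1_facts:
  fixes E :: "'v::finite \<Rightarrow> 'v \<Rightarrow> bool"
  assumes "simple_graph E" "0 \<le> k" "k \<le> real CARD('v)"
  defines "X \<equiv> (k / real CARD('v)) *\<^sub>R mat 1 :: real ^ 'v ^ 'v"
  shows "psd X" "X \<preceq> mat 1" "mat_inner (mat 1) X = k" "schur (adj_matrix E) X = 0"
proof -
  show "psd X"
    unfolding X_def using assms by (intro psd_scaled_mat_1) auto
  have "mat 1 - X = (1 - k / real CARD('v)) *\<^sub>R mat 1"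
    by (simp add: X_def scaleR_left_diff_distrib)
  moreover have "k / real CARD('v) \<le> 1"
    using assms by (simp add: divide_le_eq)
  ultimately show "X \<preceq> mat 1"
    by (simp add: loewner_le_def psd_scaled_mat_1)
  show "mat_inner (mat 1) X = k"
    by (simp add: mat_inner_def X_def trace_def) (simp add: mat_def)
  show "schur (adj_matrix E) X = 0"
    using assms(1)
    by (auto simp: schur_def X_def mat_def vec_eq_iff adj_matrix_def simple_graph_def irreflp_def)
qed

lemma theta_attained:
  fixes E :: "'v::finite \<Rightarrow> 'v \<Rightarrow> bool"
  assumes "simple_graph E" "0 \<le> k" "k \<le> real CARD('v)"
  shows "\<exists>X \<in> theta_feasible k E. theta k E = mat_inner all_ones X \<and>
    (\<forall>X' \<in> theta_feasible k E. mat_inner all_ones X' \<le> mat_inner all_ones X)"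
proof -
  have "theta_feasible k E \<noteq> {}"
    using scaled_mat_1_facts[OF assms] by (auto simp: theta_feasible_def loewner_le_def psd_def)
  then show ?thesis
    unfolding theta_def
    by (intro Greatest_attained compact_theta_feasible continuous_intros)
qed

lemma phi_attained:
  fixes E :: "'v::finite \<Rightarrow> 'v \<Rightarrow> bool"
  assumes "simple_graph E" "0 \<le> k" "k \<le> real CARD('v)"
  shows "\<exists>(M, Y) \<in> phi_feasible k E. phi k E = mat_inner M Y \<and>
    (\<forall>(M', Y') \<in> phi_feasible k E. mat_inner M' Y' \<le> mat_inner M Y)"
proof -
  have "psd (mat 1 :: real ^ 'v ^ 'v)"
    using psd_scaled_mat_1[of 1] by simp
  moreover have "schur (adj_matrix E) (mat 1) = 0"
    using assms(1)
    by (auto simp: schur_def mat_def vec_eq_iff adj_matrix_def simple_graph_def irreflp_def)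
  ultimately have "phi_feasible k E \<noteq> {}"
    using scaled_mat_1_facts[OF assms]
    by (force simp: phi_feasible_def diag_vec_def mat_def)
  then have "\<exists>p\<in>phi_feasible k E.
      (GREATEST r. \<exists>p\<in>phi_feasible k E. r = mat_inner (fst p) (snd p)) = mat_inner (fst p) (snd p) \<and>
      (\<forall>q\<in>phi_feasible k E. mat_inner (fst q) (snd q) \<le> mat_inner (fst p) (snd p))"
    by (intro Greatest_attained compact_phi_feasible continuous_intros)
  then show ?thesis
    unfolding phi_def by (simp add: case_prod_beta)
qed

end

theory Submission
  imports Defs
begin

text \<open>
  The inequality between \<open>phi\<close> and \<open>theta\<close> is an instance of the Schur product theorem
  (\<open>psd_schur\<close>). If \<open>(M, Y)\<close> is feasible for \<open>phi\<close>, then \<open>X = schur M Y\<close> is feasible for \<open>theta\<close>: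
  it is positive semidefinite, it vanishes on the edges because \<open>Y\<close> does, and since \<open>Y\<close> has unit
  diagonal, \<open>X\<close> has the same diagonal as \<open>M\<close> and \<open>mat 1 - X = schur (mat 1 - M) Y\<close> is positive
  semidefinite too. The entries of \<open>X\<close> sum to the inner product of \<open>M\<close> and \<open>Y\<close>. The Schur
  product theorem itself is reduced, by \<open>psd_induct\<close>, to the case of a rank-one factor; the
  rank-one summands come from Gaussian elimination.

  The inequality between \<open>alpha\<close> and \<open>phi\<close> comes from a feasible pair attached to a coloured set
  \<open>S\<close> (\<open>colorable_le_phi\<close>). Let \<open>Y\<close> be the 0/1 matrix of the partition of the vertices into the
  colour classes of \<open>S\<close> and singletons, and let \<open>M\<close> be the orthogonal projection onto the span of
  the indicator vectors of the colour classes. A class of size \<open>s\<close> contributes \<open>s * s\<close> entries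
  \<open>1 / s\<close> to \<open>M\<close>, all at positions where \<open>Y\<close> is 1, so the inner product of \<open>M\<close> and \<open>Y\<close> is the
  number of vertices of \<open>S\<close>. The trace of \<open>M\<close> is the number of colours that occur, which may be
  less than \<open>k\<close>; \<open>phi_ge_smaller_trace\<close> repairs this.
\<close>

section \<open>Positive semidefinite matrices\<close>

lemma sym_mat_iff: "sym_mat A \<longleftrightarrow> (\<forall>u v. A $ u $ v = A $ v $ u)"
  by (auto simp: sym_mat_def transpose_def vec_eq_iff)

lemma quadratic_form_eq_sum:
  fixes A :: "real ^ 'v ^ 'v::finite"
  shows "x \<bullet> (A *v x) = (\<Sum>u\<in>UNIV. \<Sum>v\<in>UNIV. A $ u $ v * (x $ u * x $ v))"
  by (simp add: inner_vec_def matrix_vector_mult_def sum_distrib_left mult_ac)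

lemma mat_inner_eq_sum:
  assumes "sym_mat B"
  shows "mat_inner A B = (\<Sum>u\<in>UNIV. \<Sum>v\<in>UNIV. A $ u $ v * B $ u $ v)"
  using assms unfolding mat_inner_def trace_def matrix_matrix_mult_def sym_mat_iff
  by (auto intro!: sum.cong)

lemma mat_inner_mat_1: "mat_inner (mat 1) A = (\<Sum>u\<in>UNIV. A $ u $ u)"
  by (simp add: mat_inner_def trace_def)

lemma psd_add:
  assumes "psd A" "psd B"
  shows "psd (A + B)"
  using assms unfolding psd_def sym_mat_iff
  by (auto simp: matrix_vector_mult_add_rdistrib inner_add_right)

lemma psd_scaleR:
  assumes "psd A" "0 \<le> c"
  shows "psd (c *\<^sub>R A)"
  using assms unfolding psd_def sym_mat_iff
  by (auto simp: scaleR_matrix_vector_assoc[symmetric])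

lemma psd_zero_diag_imp_zero:
  assumes "psd A" "A $ u $ u = 0" "A $ v $ v = 0"
  shows "A $ u $ v = 0"
  using psd_entry_bound[OF assms(1), of u v] assms(2,3) by simp

text \<open>\<open>P\<close> is the orthogonal projection onto its range and \<open>mat 1 - P\<close> the one onto the orthogonal
  complement; their quadratic forms are the squared lengths of the two components of a vector.\<close>

lemma psd_symmetric_idempotent:
  fixes P :: "real ^ 'v ^ 'v::finite"
  assumes "sym_mat P" "P ** P = P"
  shows "psd P" "P \<preceq> mat 1"
proof -
  have *: "psd Q" if "sym_mat Q" "\<And>x. Q *v (Q *v x) = Q *v x" for Q :: "real ^ 'v ^ 'v"
  proof -
    have "x \<bullet> (Q *v x) = (Q *v x) \<bullet> (Q *v x)" for x
      using that by (metis dot_lmul_matrix sym_mat_def transpose_matrix_vector)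
    then show ?thesis
      using that(1) by (simp add: psd_def)
  qed
  have PP: "P *v (P *v x) = P *v x" for x
    using assms(2) by (simp add: matrix_vector_mul_assoc)
  show "psd P"
    using * assms(1) PP by blast
  have "sym_mat (mat 1 - P)"
    using assms(1) by (auto simp: sym_mat_iff mat_def)
  moreover have "(mat 1 - P) *v ((mat 1 - P) *v x) = (mat 1 - P) *v x" for x
    by (simp add: matrix_vector_mult_diff_rdistrib matrix_vector_mult_diff_distrib PP)
  ultimately show "P \<preceq> mat 1"
    unfolding loewner_le_def by (rule *)
qed

text \<open>The quadratic form adds up \<open>x\<close> over each fibre of \<open>f\<close> and sums the squares of the results.\<close>

lemma psd_same_label:
  fixes f :: "'v::finite \<Rightarrow> 'a"
  shows "psd (\<chi> u v. if f u = f v then 1 else 0)" (is "psd ?Y")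
proof -
  have "0 \<le> x \<bullet> (?Y *v x)" for x
  proof -
    define s where "s l = (\<Sum>v | f v = l. x $ v)" for l
    have "(?Y *v x) $ u = s (f u)" for u
      unfolding matrix_vector_mult_def s_def
      by (auto intro!: sum.mono_neutral_cong_right split: if_splits)
    then have "x \<bullet> (?Y *v x) = (\<Sum>u\<in>UNIV. x $ u * s (f u))"
      by (simp add: inner_vec_def)
    also have "\<dots> = (\<Sum>l\<in>range f. \<Sum>u | f u = l. x $ u * s (f u))"
      by (subst sum.image_gen[of UNIV _ f]) auto
    also have "\<dots> = (\<Sum>l\<in>range f. s l * s l)"
      by (auto intro!: sum.cong simp: s_def sum_distrib_right)
    also have "\<dots> \<ge> 0"
      by (intro sum_nonneg) auto
    finally show ?thesis .
  qed
  then show ?thesis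
    by (auto simp: psd_def sym_mat_iff)
qed

section \<open>The Schur product theorem\<close>

definition outer_square :: "real ^ 'v \<Rightarrow> real ^ 'v ^ 'v" where
  "outer_square a = (\<chi> u v. a $ u * a $ v)"

text \<open>One step of symmetric Gaussian elimination with pivot \<open>A $ w $ w\<close>. The quadratic form of the
  Schur complement at \<open>x\<close> is the minimum of the quadratic form of \<open>A\<close> on the line through \<open>x\<close> in
  direction \<open>axis w 1\<close>.\<close>

lemma psd_schur_complement:
  fixes A :: "real ^ 'v ^ 'v::finite"
  assumes A: "psd A" and pos: "0 < A $ w $ w"
  shows "psd (A - (1 / A $ w $ w) *\<^sub>R outer_square (A $ w))" (is "psd ?B")
proof -
  let ?d = "A $ w $ w"
  have sym: "A $ u $ v = A $ v $ u" for u v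
    using A by (simp add: psd_def sym_mat_iff)
  have "0 \<le> x \<bullet> (?B *v x)" for x
  proof -
    define b where "b = A $ w \<bullet> x"
    \<comment> \<open>The minimiser of the quadratic form on that line.\<close>
    define y where "y = x - (b / ?d) *\<^sub>R axis w 1"
    have col: "A *v axis w 1 = A $ w"
      by (simp add: matrix_vector_mult_basis column_def vec_eq_iff sym)
    have row: "(A *v x) $ w = b"
      by (simp add: b_def matrix_vector_mult_def inner_vec_def)
    have "0 \<le> y \<bullet> (A *v y)"
      using A by (simp add: psd_def)
    also have "y \<bullet> (A *v y) = x \<bullet> (A *v x) - b * b / ?d"
      using pos unfolding y_def
      by (simp add: matrix_vector_mult_diff_distrib matrix_vector_mult_scaleR col
          inner_diff_left inner_diff_right row inner_axis' b_def[symmetric]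
          inner_commute[of x "A $ w"] field_simps)
    also have "\<dots> = x \<bullet> (?B *v x)"
    proof -
      have "x \<bullet> (outer_square (A $ w) *v x) = b * b"
        unfolding quadratic_form_eq_sum
        by (simp add: outer_square_def b_def inner_vec_def sum_product mult_ac)
      then show ?thesis
        by (simp add: matrix_vector_mult_diff_rdistrib inner_diff_right
            scaleR_matrix_vector_assoc[symmetric])
    qed
    finally show ?thesis .
  qed
  then show ?thesis
    by (auto simp: psd_def sym_mat_iff outer_square_def sym mult.commute)
qed

text \<open>Every positive semidefinite matrix is a sum of matrices \<open>outer_square a\<close>. Each elimination step
  splits off one such summand and clears the pivot, so the number of nonzero diagonal entries
  decreases; once the diagonal is zero, so is the matrix.\<close>

lemma psd_induct [consumes 1, case_names zero add]:
  fixes A :: "real ^ 'v ^ 'v::finite"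
  assumes "psd A"
    and "P 0"
    and "\<And>A a. psd A \<Longrightarrow> P A \<Longrightarrow> P (A + outer_square a)"
  shows "P A"
  using assms(1)
proof (induction "card {u. A $ u $ u \<noteq> 0}" arbitrary: A rule: less_induct)
  case less
  show ?case
  proof (cases "\<exists>w. A $ w $ w \<noteq> 0")
    case False
    then have "A = 0"
      using psd_zero_diag_imp_zero[OF less.prems] by (simp add: vec_eq_iff)
    with assms(2) show ?thesis by simp
  next
    case True
    then obtain w where w: "A $ w $ w \<noteq> 0" by blast
    with psd_diag_nonneg[OF less.prems, of w] have pos: "0 < A $ w $ w" by linarith
    define a where "a = (1 / sqrt (A $ w $ w)) *\<^sub>R (A $ w)"
    define B where "B = A - outer_square a"
    have a_sq: "a $ u * a $ u = A $ w $ u * A $ w $ u / A $ w $ w" for u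
      using pos by (simp add: a_def)
    have "outer_square a = (1 / A $ w $ w) *\<^sub>R outer_square (A $ w)"
      using pos by (simp add: a_def outer_square_def vec_eq_iff)
    then have B: "psd B"
      unfolding B_def using psd_schur_complement[OF less.prems pos] by simp
    have diag: "B $ u $ u = A $ u $ u - a $ u * a $ u" for u
      by (simp add: B_def outer_square_def)
    have "B $ u $ u = 0" if "A $ u $ u = 0" for u
      using psd_diag_nonneg[OF B, of u] zero_le_square[of "a $ u"] that
      unfolding diag by linarith
    moreover have "B $ w $ w = 0"
      unfolding diag a_sq using w by simp
    ultimately have "{u. B $ u $ u \<noteq> 0} \<subset> {u. A $ u $ u \<noteq> 0}"
      using w by blast
    then have "card {u. B $ u $ u \<noteq> 0} < card {u. A $ u $ u \<noteq> 0}"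
      by (intro psubset_card_mono) auto
    from assms(3)[OF B less.hyps[OF this B], of a] show ?thesis
      by (simp add: B_def)
  qed
qed

text \<open>As \<open>schur A B\<close> is additive in \<open>A\<close>, it suffices to treat \<open>outer_square a\<close>: its entrywise product
  with \<open>B\<close> is a congruence transform of \<open>B\<close> by the diagonal matrix with entries \<open>a\<close>.\<close>

theorem psd_schur:
  fixes A B :: "real ^ 'v ^ 'v::finite"
  assumes "psd A" "psd B"
  shows "psd (schur A B)"
  using assms(1)
proof (induction rule: psd_induct)
  case zero
  have "schur 0 B = 0"
    by (simp add: schur_def vec_eq_iff)
  then show ?case
    using psd_scaleR[OF assms(2), of 0] by simp
next
  case (add A a)
  have "0 \<le> x \<bullet> (schur (outer_square a) B *v x)" for x
  proof -
    have "x \<bullet> (schur (outer_square a) B *v x) = (\<chi> u. a $ u * x $ u) \<bullet> (B *v (\<chi> u. a $ u * x $ u))"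
      by (simp add: quadratic_form_eq_sum schur_def outer_square_def mult_ac)
    then show ?thesis
      using assms(2) by (simp add: psd_def)
  qed
  then have "psd (schur (outer_square a) B)"
    using assms(2) by (simp add: psd_def sym_mat_iff schur_def outer_square_def mult.commute)
  moreover have "schur (A + outer_square a) B = schur A B + schur (outer_square a) B"
    by (simp add: schur_def vec_eq_iff distrib_right)
  ultimately show ?case
    using add.IH by (simp add: psd_add)
qed

corollary psd_mat_inner_nonneg:
  fixes A B :: "real ^ 'v ^ 'v::finite"
  assumes "psd A" "psd B"
  shows "0 \<le> mat_inner A B"
proof -
  have "0 \<le> 1 \<bullet> (schur A B *v 1)"
    using psd_schur[OF assms] unfolding psd_def by blast
  then show ?thesis
    using assms(2) by (simp add: mat_inner_eq_sum psd_def quadratic_form_eq_sum schur_def)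
qed

section \<open>The upper bound on \<open>phi\<close>\<close>

lemma schur_phi_feasible:
  assumes "(M, Y) \<in> phi_feasible k E"
  shows "schur M Y \<in> theta_feasible k E" "mat_inner all_ones (schur M Y) = mat_inner M Y"
proof -
  have M: "psd M" "psd (mat 1 - M)" "mat_inner (mat 1) M = k"
    and Y: "psd Y" "\<And>u. Y $ u $ u = 1" "schur (adj_matrix E) Y = 0"
    using assms by (auto simp: phi_feasible_def loewner_le_def diag_vec_def vec_eq_iff)
  have "psd (schur M Y)"
    using M Y by (intro psd_schur)
  moreover have "mat 1 - schur M Y = schur (mat 1 - M) Y"
    using Y(2) by (auto simp: schur_def mat_def vec_eq_iff)
  then have "schur M Y \<preceq> mat 1"
    unfolding loewner_le_def using M Y by (simp add: psd_schur)
  moreover have "mat_inner (mat 1) (schur M Y) = k"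
    using M(3) Y(2) by (simp add: mat_inner_mat_1 schur_def)
  moreover have "schur (adj_matrix E) (schur M Y) = 0"
    using Y(3) by (auto simp: schur_def vec_eq_iff)
  ultimately show "schur M Y \<in> theta_feasible k E"
    by (simp add: theta_feasible_def loewner_le_def psd_def)
  show "mat_inner all_ones (schur M Y) = mat_inner M Y"
    using Y(1) \<open>psd (schur M Y)\<close>
    by (simp add: mat_inner_eq_sum psd_def) (simp add: all_ones_def schur_def)
qed

lemma phi_le_theta:
  fixes E :: "'v::finite \<Rightarrow> 'v \<Rightarrow> bool"
  assumes "simple_graph E" "0 \<le> k" "k \<le> real CARD('v)"
  shows "phi k E \<le> theta k E"
  using phi_attained[OF assms] theta_attained[OF assms] schur_phi_feasible[of _ _ k E] by fastforce

section \<open>The lower bound on \<open>phi\<close>\<close>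

text \<open>A matrix \<open>M\<close> of too small a trace is moved towards the identity until its trace is \<open>k\<close>; this adds
  a multiple of the positive semidefinite matrix \<open>mat 1 - M\<close>, so the objective does not decrease.\<close>

lemma phi_ge_smaller_trace:
  fixes E :: "'v::finite \<Rightarrow> 'v \<Rightarrow> bool"
  assumes E: "simple_graph E" and k: "0 \<le> k" "k \<le> real CARD('v)"
    and feas: "(M, Y) \<in> phi_feasible m E" and "m \<le> k"
  shows "mat_inner M Y \<le> phi k E"
proof -
  have M: "psd M" "psd (mat 1 - M)" "mat_inner (mat 1) M = m"
    and Y: "psd Y" "diag_vec Y = (\<chi> u. 1)" "schur (adj_matrix E) Y = 0"
    using feas by (auto simp: phi_feasible_def loewner_le_def)
  \<comment> \<open>If \<open>m = CARD('v)\<close>, then \<open>m = k\<close> and \<open>t = 0 / 0 = 0\<close>, as desired.\<close>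
  define t where "t = (k - m) / (real CARD('v) - m)"
  define M' where "M' = M + t *\<^sub>R (mat 1 - M)"
  have t: "0 \<le> t" "t \<le> 1" "t * (real CARD('v) - m) = k - m"
    using k \<open>m \<le> k\<close> by (auto simp: t_def divide_le_eq)
  have "psd M'"
    unfolding M'_def using M t by (intro psd_add psd_scaleR)
  moreover have "mat 1 - M' = (1 - t) *\<^sub>R (mat 1 - M)"
    by (simp add: M'_def algebra_simps)
  then have "M' \<preceq> mat 1"
    unfolding loewner_le_def using M t by (simp add: psd_scaleR)
  moreover have "mat_inner (mat 1) M' = k"
    using M(3) t(3)
    by (simp add: M'_def mat_inner_mat_1 sum.distrib sum_subtractf sum_distrib_left[symmetric])
       (simp add: mat_def)
  ultimately have "(M', Y) \<in> phi_feasible k E"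
    using Y by (simp add: phi_feasible_def)
  then have "mat_inner M' Y \<le> phi k E"
    using phi_attained[OF E k] by fastforce
  moreover have "mat_inner M' Y = mat_inner M Y + t * mat_inner (mat 1 - M) Y"
    using Y(1) unfolding M'_def
    by (simp add: mat_inner_eq_sum psd_def distrib_right sum.distrib sum_distrib_left mult.assoc)
  moreover have "0 \<le> t * mat_inner (mat 1 - M) Y"
    using psd_mat_inner_nonneg[OF M(2) Y(1)] t(1) by simp
  ultimately show ?thesis by linarith
qed

text \<open>The orthogonal projection onto the span of the indicator vectors of the colour classes of \<open>S\<close>
  under the colouring \<open>c\<close>: it averages a vector over each class and vanishes outside \<open>S\<close>.\<close>

definition class_projection :: "'v set \<Rightarrow> ('v \<Rightarrow> 'a) \<Rightarrow> real ^ 'v ^ 'v" where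
  "class_projection S c =
     (\<chi> u v. if u \<in> S \<and> v \<in> S \<and> c u = c v then 1 / card {w \<in> S. c w = c u} else 0)"

context
  fixes S :: "'v::finite set" and c :: "'v \<Rightarrow> 'a"
begin

lemma sym_mat_class_projection: "sym_mat (class_projection S c)"
  by (auto simp: sym_mat_iff class_projection_def)

lemma class_projection_row_sum:
  "(\<Sum>v\<in>UNIV. class_projection S c $ u $ v) = (if u \<in> S then 1 else 0)"
proof (cases "u \<in> S")
  case True
  have "(\<Sum>v\<in>UNIV. class_projection S c $ u $ v) =
      (\<Sum>v\<in>{w \<in> S. c w = c u}. 1 / card {w \<in> S. c w = c u})"
    using True by (intro sum.mono_neutral_cong_right) (auto simp: class_projection_def)
  moreover have "card {w \<in> S. c w = c u} \<noteq> 0"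
    using True by auto
  ultimately show ?thesis
    using True by simp
qed (simp add: class_projection_def)

lemma class_projection_idempotent:
  "class_projection S c ** class_projection S c = class_projection S c"
proof -
  let ?P = "class_projection S c"
  have "(?P ** ?P) $ u $ v = ?P $ u $ v" for u v
  proof -
    \<comment> \<open>Rows of vertices in the same class agree.\<close>
    have "?P $ u $ w * ?P $ w $ v = ?P $ u $ w * ?P $ u $ v" for w
      by (auto simp: class_projection_def)
    then have "(?P ** ?P) $ u $ v = (\<Sum>w\<in>UNIV. ?P $ u $ w) * ?P $ u $ v"
      by (simp only: matrix_matrix_mult_def vec_lambda_beta sum_distrib_right)
    then show ?thesis
      by (simp add: class_projection_row_sum) (simp add: class_projection_def)
  qed
  then show ?thesis
    by (simp add: vec_eq_iff)
qed

lemma trace_class_projection: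
  "mat_inner (mat 1) (class_projection S c) = real (card (c ` S))"
proof -
  have "mat_inner (mat 1) (class_projection S c) = (\<Sum>u\<in>S. 1 / card {w \<in> S. c w = c u})"
    unfolding mat_inner_mat_1
    by (intro sum.mono_neutral_cong_right) (auto simp: class_projection_def)
  also have "\<dots> = (\<Sum>l\<in>c ` S. \<Sum>u\<in>{w \<in> S. c w = l}. 1 / card {w \<in> S. c w = c u})"
    by (intro sum.image_gen) simp
  also have "\<dots> = (\<Sum>l\<in>c ` S. 1)"
  proof (intro sum.cong refl)
    fix l assume "l \<in> c ` S"
    then have "card {w \<in> S. c w = l} \<noteq> 0" by auto
    then show "(\<Sum>u\<in>{w \<in> S. c w = l}. 1 / card {w \<in> S. c w = c u}) = 1"
      by simp
  qed
  finally show ?thesis by simp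
qed

end

text \<open>The projection onto the colour classes has trace the number of colours used. It is paired with
  the 0/1 matrix of the equivalence relation whose classes are the colour classes of \<open>S\<close> and the
  singletons outside \<open>S\<close>: no edge joins equivalent vertices because the colouring is proper.\<close>

lemma colorable_le_phi:
  fixes E :: "'v::finite \<Rightarrow> 'v \<Rightarrow> bool"
  assumes E: "simple_graph E" and k: "k \<le> CARD('v)" and S: "induced_colorable k E S"
  shows "real (card S) \<le> phi (real k) E"
proof -
  obtain c :: "'v \<Rightarrow> nat" where c: "\<And>u. u \<in> S \<Longrightarrow> c u < k"
    "\<And>u v. u \<in> S \<Longrightarrow> v \<in> S \<Longrightarrow> E u v \<Longrightarrow> c u \<noteq> c v"
    using S unfolding induced_colorable_def by blast
  define M where "M = class_projection S c"
  define f :: "'v \<Rightarrow> nat + 'v" where "f u = (if u \<in> S then Inl (c u) else Inr u)" for u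
  define Y :: "real ^ 'v ^ 'v" where "Y = (\<chi> u v. if f u = f v then 1 else 0)"
  have Y: "psd Y"
    unfolding Y_def by (rule psd_same_label)
  have "f u \<noteq> f v" if "E u v" for u v
    using that c(2)[of u v] E by (auto simp: f_def simple_graph_def irreflp_def)
  then have "schur (adj_matrix E) Y = 0"
    by (auto simp: schur_def adj_matrix_def Y_def vec_eq_iff)
  moreover have "psd M" "M \<preceq> mat 1"
    unfolding M_def
    by (intro psd_symmetric_idempotent sym_mat_class_projection class_projection_idempotent)+
  ultimately have "(M, Y) \<in> phi_feasible (real (card (c ` S))) E"
    using Y by (simp add: phi_feasible_def M_def trace_class_projection)
      (simp add: diag_vec_def Y_def)
  moreover have "card (c ` S) \<le> k"
    using c(1) by (metis card_lessThan card_mono finite_lessThan image_subsetI lessThan_iff)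
  ultimately have "mat_inner M Y \<le> phi (real k) E"
    using E k by (intro phi_ge_smaller_trace) auto
  moreover have "mat_inner M Y = real (card S)"
  proof -
    have "M $ u $ v * Y $ u $ v = M $ u $ v" for u v
      by (auto simp: M_def Y_def class_projection_def f_def)
    then have "mat_inner M Y = (\<Sum>u\<in>UNIV. \<Sum>v\<in>UNIV. M $ u $ v)"
      using Y by (simp only: mat_inner_eq_sum psd_def)
    also have "\<dots> = (\<Sum>u\<in>UNIV. if u \<in> S then 1 else 0)"
      by (simp add: M_def class_projection_row_sum)
    finally show ?thesis by (simp add: sum.If_cases)
  qed
  ultimately show ?thesis by simp
qed

lemma alpha_attained: "\<exists>S. induced_colorable k E S \<and> card S = alpha k E"
proof -
  have "induced_colorable k E {}"
    by (simp add: induced_colorable_def)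
  then have "alpha k E \<in> {card S | S. induced_colorable k E S}"
    unfolding alpha_def by (intro Max_in) auto
  then show ?thesis by auto
qed

theorem theorem8:
  fixes E :: "'v::finite \<Rightarrow> 'v \<Rightarrow> bool"
  assumes "simple_graph E"
  shows "(\<forall>k::nat. 1 \<le> k \<and> k \<le> CARD('v) \<longrightarrow>
            real (alpha k E) \<le> phi (real k) E \<and> phi (real k) E \<le> theta (real k) E) \<and>
         (\<forall>k::real. 0 \<le> k \<and> k \<le> real CARD('v) \<longrightarrow> phi k E \<le> theta k E)"
proof -
  have "real (alpha k E) \<le> phi (real k) E" if "k \<le> CARD('v)" for k
    using colorable_le_phi[OF assms that] alpha_attained[of k E] by metis
  then show ?thesis
    using phi_le_theta[OF assms] by simp
qed

end
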